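(* Let $N=n+s+r$ with $N,n\ge1$, let $A_1,\dots,A_m\subseteq\{0,1\}^{n+s}$ and $B_1,\dots,B_\ell\subseteq\{0,1\}^{n+r}$ be sets defined by $R(LIN/\mathbf F_2)$-clauses, and let $U,V\subseteq\{0,1\}^n$ be the associated sets (see context), both non-empty. Assume the monotonicity condition: for all $u,u'\in\{0,1\}^n$, $b\in\{0,1\}^s$, if $(u,b)\in\bigcap_{j\le m}A_j$ and $u'\ge u$ then $(u',b)\in\bigcap_{j\le m}A_j$. Let $\pi$ be an $R(LIN/\mathbf F_2)$ refutation of (the clauses defining) these sets with $k$ steps. Let $w\ge1$ be any parameter. Then there is a monotone circuit with a local oracle (CLO) of size at most $(k+n)2^{O(w\log n)}$ and of locality at most $3\cdot2^{-w}k$ separating $U$ from $V$. Moreover, if the refutation $\pi$ is tree-like then the monotone CLO is a formula.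
   Context: $O(\cdot)$ hides an absolute constant. Set-up. $U=\{u\in\{0,1\}^n:\exists b\in\{0,1\}^s,\ (u,b)\in\bigcap_{j\le m}A_j\}$, $V=\{v\in\{0,1\}^n:\exists c\in\{0,1\}^r,\ (v,c)\in\bigcap_{j\le\ell}B_j\}$. The $N$ propositional variables are split as $x$ ($n$ of them), $y$ ($s$ of them), $z$ ($r$ of them); the $A_j$ are defined by clauses in $x,y$ and the $B_j$ by clauses in $x,z$. The order on $\{0,1\}^n$ is coordinatewise. $R(LIN/\mathbf F_2)$. A clause is a finite set $C=\{f_1,\dots,f_p\}$ of linear (i.e. degree $\le1$) polynomials over $\mathbf F_2$; it is true under a $0/1$ assignment iff some $f_i$ takes value $1$, and it defines the set of assignments making it true. Rules: ($\mathbf F_2$-axiom) infer $h,h+1$ from nothing; (weakening) from $C$ infer $C,f$; (contraction) from $C,0$ infer $C$; (binary rule) from $C,g$ and $C,h$ infer $C,g+h+1$. A refutation of a set of clauses is a derivation of the empty clause from these clauses by the rules; it is tree-like if each line is used at most once as a premise. Monotone CLO. A monotone circuit with a local oracle separating $U$ from $V$ consists of (1) a monotone Boolean circuit $D(x_1,\dots,x_n,y_1,\dots,y_e)$ and (2) a set of combinatorial rectangles $U_j\times V_j\subseteq U\times V$, $j\le e$ (oracle rectangles), such that (3) for all monotone Boolean functions $f_j:\{0,1\}^n\to\{0,1\}$, $j\le e$, with $f_j(U_j)\subseteq\{1\}$ and $f_j(V_j)\subseteq\{0\}$, the function $C(\overline x):=D(\overline x,f_1(\overline x),\dots,f_e(\overline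 x))$ satisfies $C(U)=\{1\}$ and $C(V)=\{0\}$. Its size is the size (number of nodes) of $D$ and its locality is $|\bigcup_{j\le e}U_j\times V_j|/|U\times V|$. The CLO is a formula if $D$ is a formula. *)

theory Defs
  imports Complex_Main "HOL-Library.Z2" "HOL-Library.Poly_Mapping" "HOL-Library.Product_Plus"
begin

text \<open>Variables are indexed from 0: the x-variables are \<open>XVar i\<close> with \<open>i < n\<close>, and so on.\<close>

datatype pvar = XVar nat | YVar nat | ZVar nat

definition xy_vars :: "nat \<Rightarrow> nat \<Rightarrow> pvar set" where
  "xy_vars n s = XVar ` {..<n} \<union> YVar ` {..<s}"

definition xz_vars :: "nat \<Rightarrow> nat \<Rightarrow> pvar set" where
  "xz_vars n r = XVar ` {..<n} \<union> ZVar ` {..<r}"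

definition xyz_vars :: "nat \<Rightarrow> nat \<Rightarrow> nat \<Rightarrow> pvar set" where
  "xyz_vars n s r = XVar ` {..<n} \<union> YVar ` {..<s} \<union> ZVar ` {..<r}"

text \<open>The pair \<open>(a, c)\<close> stands for the polynomial \<open>(\<Sum>v. a v * v) + c\<close> over the two-element
  field; sum and zero polynomial are the componentwise ones of the product type.\<close>

type_synonym linpoly = "(pvar \<Rightarrow>\<^sub>0 bit) \<times> bit"

definition lin_one :: linpoly where
  "lin_one = (0, 1)"

definition lin_eval :: "(pvar \<Rightarrow> bool) \<Rightarrow> linpoly \<Rightarrow> bit" where
  "lin_eval a f =
     (\<Sum>v\<in>Poly_Mapping.keys (fst f). Poly_Mapping.lookup (fst f) v * of_bool (a v)) + snd f"

type_synonym clause = "linpoly set"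

definition clause_over :: "pvar set \<Rightarrow> clause \<Rightarrow> bool" where
  "clause_over W C \<longleftrightarrow> finite C \<and> (\<forall>f\<in>C. Poly_Mapping.keys (fst f) \<subseteq> W)"

definition clause_true :: "(pvar \<Rightarrow> bool) \<Rightarrow> clause \<Rightarrow> bool" where
  "clause_true a C \<longleftrightarrow> (\<exists>f\<in>C. lin_eval a f = 1)"


definition cube :: "nat \<Rightarrow> bool list set" where
  "cube n = {u. length u = n}"

definition cube_le :: "bool list \<Rightarrow> bool list \<Rightarrow> bool" where
  "cube_le u u' \<longleftrightarrow> list_all2 (\<le>) u u'"

text \<open>The values given to the variables outside of x, y (outside of x, z) are immaterial, since
  these assignments are only applied to clauses in x, y (in x, z).\<close>

definition assign_xy :: "bool list \<Rightarrow> bool list \<Rightarrow> pvar \<Rightarrow> bool" where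
  "assign_xy u b v = (case v of XVar i \<Rightarrow> u ! i | YVar i \<Rightarrow> b ! i | ZVar i \<Rightarrow> False)"

definition assign_xz :: "bool list \<Rightarrow> bool list \<Rightarrow> pvar \<Rightarrow> bool" where
  "assign_xz u c v = (case v of XVar i \<Rightarrow> u ! i | YVar i \<Rightarrow> False | ZVar i \<Rightarrow> c ! i)"

definition A_set :: "nat \<Rightarrow> nat \<Rightarrow> clause \<Rightarrow> (bool list \<times> bool list) set" where
  "A_set n s C = {(u, b) \<in> cube n \<times> cube s. clause_true (assign_xy u b) C}"

definition B_set :: "nat \<Rightarrow> nat \<Rightarrow> clause \<Rightarrow> (bool list \<times> bool list) set" where
  "B_set n r C = {(v, c) \<in> cube n \<times> cube r. clause_true (assign_xz v c) C}"

text \<open>Intersecting with the cube matters only for the empty family of clauses.\<close>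

definition A_inter :: "nat \<Rightarrow> nat \<Rightarrow> nat \<Rightarrow> (nat \<Rightarrow> clause) \<Rightarrow> (bool list \<times> bool list) set" where
  "A_inter n s m A = (cube n \<times> cube s) \<inter> (\<Inter>j<m. A_set n s (A j))"

definition B_inter :: "nat \<Rightarrow> nat \<Rightarrow> nat \<Rightarrow> (nat \<Rightarrow> clause) \<Rightarrow> (bool list \<times> bool list) set" where
  "B_inter n r l B = (cube n \<times> cube r) \<inter> (\<Inter>j<l. B_set n r (B j))"

definition U_set :: "nat \<Rightarrow> nat \<Rightarrow> nat \<Rightarrow> (nat \<Rightarrow> clause) \<Rightarrow> bool list set" where
  "U_set n s m A = {u \<in> cube n. \<exists>b\<in>cube s. (u, b) \<in> A_inter n s m A}"

definition V_set :: "nat \<Rightarrow> nat \<Rightarrow> nat \<Rightarrow> (nat \<Rightarrow> clause) \<Rightarrow> bool list set" where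
  "V_set n r l B = {v \<in> cube n. \<exists>c\<in>cube r. (v, c) \<in> B_inter n r l B}"


text \<open>A derivation is a list of lines; each line is a clause together with the way it was obtained,
  where numbers refer to the positions of the premises in the list.\<close>

datatype inference = Initial | F2_Axiom | Weakening nat | Contraction nat | Binary nat nat

type_synonym derivation = "(clause \<times> inference) list"

fun prem_lines :: "inference \<Rightarrow> nat list" where
  "prem_lines Initial = []"
| "prem_lines F2_Axiom = []"
| "prem_lines (Weakening p) = [p]"
| "prem_lines (Contraction p) = [p]"
| "prem_lines (Binary p q) = [p, q]"

fun valid_inference :: "clause set \<Rightarrow> derivation \<Rightarrow> clause \<Rightarrow> inference \<Rightarrow> bool" where
  "valid_inference \<Phi> \<pi> C Initial \<longleftrightarrow> C \<in> \<Phi>"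
| "valid_inference \<Phi> \<pi> C F2_Axiom \<longleftrightarrow> (\<exists>h. C = {h, h + lin_one})"
| "valid_inference \<Phi> \<pi> C (Weakening p) \<longleftrightarrow> (\<exists>f. C = insert f (fst (\<pi> ! p)))"
| "valid_inference \<Phi> \<pi> C (Contraction p) \<longleftrightarrow> fst (\<pi> ! p) = insert 0 C"
| "valid_inference \<Phi> \<pi> C (Binary p q) \<longleftrightarrow>
     (\<exists>E g h. fst (\<pi> ! p) = insert g E \<and> fst (\<pi> ! q) = insert h E \<and>
        C = insert (g + h + lin_one) E)"

definition is_derivation :: "pvar set \<Rightarrow> clause set \<Rightarrow> derivation \<Rightarrow> bool" where
  "is_derivation W \<Phi> \<pi> \<longleftrightarrow>
     (\<forall>i<length \<pi>. clause_over W (fst (\<pi> ! i)) \<and>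
        (\<forall>p\<in>set (prem_lines (snd (\<pi> ! i))). p < i) \<and>
        valid_inference \<Phi> \<pi> (fst (\<pi> ! i)) (snd (\<pi> ! i)))"

definition is_refutation :: "pvar set \<Rightarrow> clause set \<Rightarrow> derivation \<Rightarrow> bool" where
  "is_refutation W \<Phi> \<pi> \<longleftrightarrow> is_derivation W \<Phi> \<pi> \<and> \<pi> \<noteq> [] \<and> fst (last \<pi>) = {}"

definition tree_like :: "derivation \<Rightarrow> bool" where
  "tree_like \<pi> \<longleftrightarrow> (\<forall>i. count_list (concat (map (prem_lines \<circ> snd) \<pi>)) i \<le> 1)"


text \<open>A monotone circuit is the list of its nodes in topological order, the last one being the
  output. \<open>XIn i\<close> and \<open>YIn j\<close> are the inputs (the latter fed by the oracle functions); the
  arguments of the binary gates are positions in the list.\<close>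

datatype gate = XIn nat | YIn nat | ConstG bool | AndG nat nat | OrG nat nat

type_synonym circuit = "gate list"

fun gate_args :: "gate \<Rightarrow> nat list" where
  "gate_args (XIn i) = []"
| "gate_args (YIn j) = []"
| "gate_args (ConstG t) = []"
| "gate_args (AndG p q) = [p, q]"
| "gate_args (OrG p q) = [p, q]"

fun gate_inputs_ok :: "nat \<Rightarrow> nat \<Rightarrow> gate \<Rightarrow> bool" where
  "gate_inputs_ok n e (XIn i) \<longleftrightarrow> i < n"
| "gate_inputs_ok n e (YIn j) \<longleftrightarrow> j < e"
| "gate_inputs_ok n e g \<longleftrightarrow> True"

definition is_circuit :: "nat \<Rightarrow> nat \<Rightarrow> circuit \<Rightarrow> bool" where
  "is_circuit n e D \<longleftrightarrow> D \<noteq> [] \<and>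
     (\<forall>i<length D. gate_inputs_ok n e (D ! i) \<and> (\<forall>p\<in>set (gate_args (D ! i)). p < i))"

fun gate_val :: "bool list \<Rightarrow> (nat \<Rightarrow> bool) \<Rightarrow> bool list \<Rightarrow> gate \<Rightarrow> bool" where
  "gate_val x y vs (XIn i) = x ! i"
| "gate_val x y vs (YIn j) = y j"
| "gate_val x y vs (ConstG t) = t"
| "gate_val x y vs (AndG p q) = (vs ! p \<and> vs ! q)"
| "gate_val x y vs (OrG p q) = (vs ! p \<or> vs ! q)"

definition circuit_val :: "circuit \<Rightarrow> bool list \<Rightarrow> (nat \<Rightarrow> bool) \<Rightarrow> bool" where
  "circuit_val D x y = last (foldl (\<lambda>vs g. vs @ [gate_val x y vs g]) [] D)"

text \<open>A formula is a circuit whose graph is a tree: every node except the output feeds exactly one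
  argument place. Several leaves may carry the same input.\<close>

definition is_formula :: "circuit \<Rightarrow> bool" where
  "is_formula D \<longleftrightarrow> (\<forall>i<length D - 1. count_list (concat (map gate_args D)) i = 1)"

definition monotone_on_cube :: "nat \<Rightarrow> (bool list \<Rightarrow> bool) \<Rightarrow> bool" where
  "monotone_on_cube n f \<longleftrightarrow> (\<forall>u\<in>cube n. \<forall>u'\<in>cube n. cube_le u u' \<longrightarrow> f u \<le> f u')"

record clo =
  circ :: circuit
  num_orc :: nat
  orc_U :: "nat \<Rightarrow> bool list set"
  orc_V :: "nat \<Rightarrow> bool list set"

definition monotone_CLO :: "nat \<Rightarrow> bool list set \<Rightarrow> bool list set \<Rightarrow> clo \<Rightarrow> bool" where
  "monotone_CLO n U V K \<longleftrightarrow>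
     is_circuit n (num_orc K) (circ K) \<and>
     (\<forall>j<num_orc K. orc_U K j \<subseteq> U \<and> orc_V K j \<subseteq> V) \<and>
     (\<forall>f :: nat \<Rightarrow> bool list \<Rightarrow> bool.
        (\<forall>j<num_orc K. monotone_on_cube n (f j) \<and>
           f j ` orc_U K j \<subseteq> {True} \<and> f j ` orc_V K j \<subseteq> {False}) \<longrightarrow>
        (\<lambda>x. circuit_val (circ K) x (\<lambda>j. f j x)) ` U = {True} \<and>
        (\<lambda>x. circuit_val (circ K) x (\<lambda>j. f j x)) ` V = {False})"

definition clo_size :: "clo \<Rightarrow> nat" where
  "clo_size K = length (circ K)"

definition clo_locality :: "bool list set \<Rightarrow> bool list set \<Rightarrow> clo \<Rightarrow> real" where
  "clo_locality U V K =
     real (card (\<Union>j<num_orc K. orc_U K j \<times> orc_V K j)) / real (card (U \<times> V))"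

end

theory Submission
  imports Defs
begin

text \<open>By soundness of the refutation, \<open>U\<close> and \<open>V\<close> are disjoint, so, \<open>U\<close> being closed upwards,
  no \<open>u \<in> U\<close> lies below a \<open>v \<in> V\<close>. Put \<open>W = \<lceil>w\<rceil>\<close> and attach to each \<open>v \<in> V\<close> the list
  \<open>Z\<close> of its first \<open>W\<close> zeros (of all its zeros, with repetitions, if there are fewer). The formula is
  the conjunction, over all lists \<open>Z\<close> of \<open>W\<close> coordinates, of the disjunctions of the \<open>x\<^sub>i\<close> with
  \<open>i\<close> in \<open>Z\<close> and of an oracle for the rectangle of those \<open>u \<in> U\<close> that vanish on \<open>Z\<close> and those
  \<open>v \<in> V\<close> to which \<open>Z\<close> is attached. If \<open>Z\<close> contains all zeros of \<open>v\<close>, no such \<open>u\<close> exists; otherwise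
  the upward closure of \<open>U\<close> shows that at most a fraction \<open>2\<^sup>-\<^sup>W\<close> of \<open>U\<close> vanishes on \<open>Z\<close>.
  As the sets \<open>V\<^sub>Z\<close> are disjoint, the locality is at most \<open>2\<^sup>-\<^sup>W\<close>.
  For \<open>n = 1\<close> the factor \<open>2\<^bsup>O(w log n)\<^esup>\<close> is 1, but then the single variable separates \<open>U\<close> from \<open>V\<close>.\<close>

section \<open>Soundness of the refutation system\<close>

text \<open>Terms outside the support contribute 0. This lets two polynomials with different
  supports be summed over a common index set.\<close>

lemma lin_eval_superset:
  assumes "finite S" "Poly_Mapping.keys (fst f) \<subseteq> S"
  shows "lin_eval a f = (\<Sum>v\<in>S. Poly_Mapping.lookup (fst f) v * of_bool (a v)) + snd f"
proof -
  have "(\<Sum>v\<in>Poly_Mapping.keys (fst f). Poly_Mapping.lookup (fst f) v * of_bool (a v))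
      = (\<Sum>v\<in>S. Poly_Mapping.lookup (fst f) v * of_bool (a v))"
    using assms by (intro sum.mono_neutral_left) (auto simp: in_keys_iff)
  then show ?thesis by (simp add: lin_eval_def)
qed

lemma lin_eval_add: "lin_eval a (f + g) = lin_eval a f + lin_eval a g"
proof -
  let ?S = "Poly_Mapping.keys (fst f) \<union> Poly_Mapping.keys (fst g)"
  have "Poly_Mapping.keys (fst (f + g)) \<subseteq> ?S"
    using Poly_Mapping.keys_add[of "fst f" "fst g"] by simp
  then show ?thesis
    \<comment> \<open>The deleted rules would turn the field operations on \<open>bit\<close> into
      XOR and AND, blocking distributivity.\<close>
    by (simp add: lin_eval_superset[where S = ?S] lookup_add distrib_right sum.distrib
        del: add_bit_eq_xor mult_bit_eq_and)
qed

lemma lin_eval_zero [simp]: "lin_eval a 0 = 0"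
  by (simp add: lin_eval_def)

lemma lin_eval_one [simp]: "lin_eval a lin_one = 1"
  by (simp add: lin_eval_def lin_one_def)

lemma lin_eval_cong:
  assumes "\<And>v. v \<in> Poly_Mapping.keys (fst f) \<Longrightarrow> a v = a' v"
  shows "lin_eval a f = lin_eval a' f"
  unfolding lin_eval_def using assms by (simp cong: sum.cong)

lemma clause_true_cong:
  assumes "clause_over W C" "\<And>v. v \<in> W \<Longrightarrow> a v = a' v"
  shows "clause_true a C \<longleftrightarrow> clause_true a' C"
proof -
  have "lin_eval a f = lin_eval a' f" if "f \<in> C" for f
    using assms that by (intro lin_eval_cong) (auto simp: clause_over_def)
  then show ?thesis by (simp add: clause_true_def)
qed

lemma clause_true_insert:
  "clause_true a (insert f C) \<longleftrightarrow> lin_eval a f = 1 \<or> clause_true a C"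
  by (auto simp: clause_true_def)

text \<open>Premises sit at smaller positions, so strong induction on the position reduces this to
  the soundness of each rule.\<close>

lemma derivation_sound:
  assumes "is_derivation W \<Phi> \<pi>" "\<forall>C\<in>\<Phi>. clause_true a C" "i < length \<pi>"
  shows "clause_true a (fst (\<pi> ! i))"
  using assms(3)
proof (induction i rule: less_induct)
  case (less i)
  have prem: "clause_true a (fst (\<pi> ! p))" if "p \<in> set (prem_lines (snd (\<pi> ! i)))" for p
    using that less assms(1) unfolding is_derivation_def by (meson less_trans)
  have valid: "valid_inference \<Phi> \<pi> (fst (\<pi> ! i)) (snd (\<pi> ! i))"
    using assms(1) less.prems by (simp add: is_derivation_def)
  show ?case
  proof (cases "snd (\<pi> ! i)")
    case Initial
    then show ?thesis using valid assms(2) by simp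
  next
    case F2_Axiom
    then obtain h where "fst (\<pi> ! i) = {h, h + lin_one}" using valid by auto
    \<comment> \<open>Over the two-element field, \<open>h\<close> or \<open>h + lin_one\<close>
      takes value 1, whichever value \<open>h\<close> has.\<close>
    then show ?thesis
      by (cases "lin_eval a h") (simp_all add: clause_true_def lin_eval_add)
  next
    case (Weakening p)
    then show ?thesis using valid prem[of p] by (auto simp: clause_true_insert)
  next
    case (Contraction p)
    then show ?thesis using valid prem[of p] by (auto simp: clause_true_insert)
  next
    case (Binary p q)
    then obtain E g h where E: "fst (\<pi> ! p) = insert g E" "fst (\<pi> ! q) = insert h E"
      "fst (\<pi> ! i) = insert (g + h + lin_one) E" using valid by auto
    then have "lin_eval a g = 1 \<or> clause_true a E" "lin_eval a h = 1 \<or> clause_true a E"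
      using prem[of p] prem[of q] Binary by (auto simp: clause_true_insert)
    \<comment> \<open>If \<open>E\<close> is false, both \<open>g\<close> and \<open>h\<close> have
      value 1, and 1 + 1 + 1 = 1.\<close>
    then show ?thesis unfolding E by (auto simp: clause_true_insert lin_eval_add)
  qed
qed

lemma refutation_sound:
  assumes "is_refutation W \<Phi> \<pi>"
  shows "\<exists>C\<in>\<Phi>. \<not> clause_true a C"
proof (rule ccontr)
  assume "\<not> ?thesis"
  then have "clause_true a (fst (\<pi> ! (length \<pi> - 1)))"
    using assms by (intro derivation_sound[of W \<Phi>]) (auto simp: is_refutation_def)
  then show False
    using assms by (auto simp: is_refutation_def last_conv_nth clause_true_def)
qed

text \<open>A common point \<open>v\<close> with witnesses \<open>b\<close> and \<open>c\<close>
  would give one assignment satisfying all initial clauses: the clauses \<open>A j\<close> do not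
  mention z and the clauses \<open>B j\<close> do not mention y, so the two witnesses cannot
  conflict.\<close>

lemma U_V_disjoint:
  assumes A: "\<forall>j<m. clause_over (xy_vars n s) (A j)"
    and B: "\<forall>j<l. clause_over (xz_vars n r) (B j)"
    and ref: "is_refutation W (A ` {..<m} \<union> B ` {..<l}) \<pi>"
  shows "U_set n s m A \<inter> V_set n r l B = {}"
proof (rule ccontr)
  assume "\<not> ?thesis"
  then obtain v b c where "(v, b) \<in> A_inter n s m A" "(v, c) \<in> B_inter n r l B"
    by (auto simp: U_set_def V_set_def)
  then have vA: "\<And>j. j < m \<Longrightarrow> clause_true (assign_xy v b) (A j)"
    and vB: "\<And>j. j < l \<Longrightarrow> clause_true (assign_xz v c) (B j)"
    by (auto simp: A_inter_def B_inter_def A_set_def B_set_def)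
  define a where "a = (\<lambda>x. case x of XVar i \<Rightarrow> v ! i | YVar i \<Rightarrow> b ! i | ZVar i \<Rightarrow> c ! i)"
  have "clause_true a (A j)" if "j < m" for j
  proof -
    have "a x = assign_xy v b x" if "x \<in> xy_vars n s" for x
      using that by (auto simp: a_def xy_vars_def assign_xy_def)
    then show ?thesis
      using clause_true_cong[of "xy_vars n s" "A j" a "assign_xy v b"] A vA that by blast
  qed
  moreover have "clause_true a (B j)" if "j < l" for j
  proof -
    have "a x = assign_xz v c x" if "x \<in> xz_vars n r" for x
      using that by (auto simp: a_def xz_vars_def assign_xz_def)
    then show ?thesis
      using clause_true_cong[of "xz_vars n r" "B j" a "assign_xz v c"] B vB that by blast
  qed
  ultimately show False
    using refutation_sound[OF ref, of a] by auto
qed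

section \<open>Up-sets of the cube\<close>

lemma finite_cube: "finite (cube n)"
  using finite_lists_length_eq[of "UNIV :: bool set" n] by (simp add: cube_def)

text \<open>Switching on an arbitrary subset of \<open>Z\<close> maps the members of \<open>U\<close> vanishing on \<open>Z\<close> injectively
  back into \<open>U\<close>.\<close>

lemma card_upset_vanishing:
  assumes U: "U \<subseteq> cube n"
    and up: "\<forall>u\<in>U. \<forall>u'\<in>cube n. cube_le u u' \<longrightarrow> u' \<in> U"
    and Z: "Z \<subseteq> {..<n}"
  shows "card {u\<in>U. \<forall>i\<in>Z. \<not> u ! i} * 2 ^ card Z \<le> card U"
proof -
  let ?U0 = "{u\<in>U. \<forall>i\<in>Z. \<not> u ! i}"
  let ?F = "\<lambda>(u, T). map (\<lambda>i. u ! i \<or> i \<in> T) [0..<n]"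
  have finU: "finite U" using U finite_cube finite_subset by blast
  have finZ: "finite Z" using Z finite_subset by blast
  have "inj_on ?F (?U0 \<times> Pow Z)"
  proof (rule inj_onI, clarify)
    fix u T u' T'
    assume u: "u \<in> U" "\<forall>i\<in>Z. \<not> u ! i" "T \<subseteq> Z" and u': "u' \<in> U" "\<forall>i\<in>Z. \<not> u' ! i" "T' \<subseteq> Z"
      and eq: "map (\<lambda>i. u ! i \<or> i \<in> T) [0..<n] = map (\<lambda>i. u' ! i \<or> i \<in> T') [0..<n]"
    have iff: "(u ! i \<or> i \<in> T) \<longleftrightarrow> (u' ! i \<or> i \<in> T')" if "i < n" for i
      using eq that by simp
    \<comment> \<open>Both lists vanish on \<open>Z\<close>, so there the images display exactly
      \<open>T\<close> and \<open>T'\<close>; off \<open>Z\<close> they display \<open>u\<close> and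
      \<open>u'\<close>.\<close>
    have "T = T'" using u u' iff Z by blast
    moreover have "u = u'"
    proof (rule nth_equalityI)
      show "length u = length u'" using u(1) u'(1) U by (auto simp: cube_def)
      show "u ! i = u' ! i" if "i < length u" for i
        using iff[of i] that u u' \<open>T = T'\<close> U unfolding cube_def by blast
    qed
    ultimately show "u = u' \<and> T = T'" by simp
  qed
  moreover have "?F ` (?U0 \<times> Pow Z) \<subseteq> U"
  proof clarify
    fix u T assume "u \<in> U"
    then have "cube_le u (map (\<lambda>i. u ! i \<or> i \<in> T) [0..<n])"
      using U by (auto simp: cube_def cube_le_def list_all2_conv_all_nth)
    then show "map (\<lambda>i. u ! i \<or> i \<in> T) [0..<n] \<in> U"
      using up \<open>u \<in> U\<close> by (simp add: cube_def)
  qed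
  ultimately have "card (?U0 \<times> Pow Z) \<le> card U"
    using finU by (rule card_inj_on_le)
  then show ?thesis
    using finZ by (simp add: card_cartesian_product card_Pow)
qed

section \<open>Monotone formulas as circuits\<close>

datatype mform = MX nat | MY nat | MConst bool | MAnd mform mform | MOr mform mform

fun mform_nodes :: "mform \<Rightarrow> nat" where
  "mform_nodes (MAnd a b) = mform_nodes a + mform_nodes b + 1"
| "mform_nodes (MOr a b) = mform_nodes a + mform_nodes b + 1"
| "mform_nodes _ = 1"

fun mform_val :: "bool list \<Rightarrow> (nat \<Rightarrow> bool) \<Rightarrow> mform \<Rightarrow> bool" where
  "mform_val x y (MX i) = x ! i"
| "mform_val x y (MY j) = y j"
| "mform_val x y (MConst t) = t"
| "mform_val x y (MAnd a b) \<longleftrightarrow> mform_val x y a \<and> mform_val x y b"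
| "mform_val x y (MOr a b) \<longleftrightarrow> mform_val x y a \<or> mform_val x y b"

fun mform_ok :: "nat \<Rightarrow> nat \<Rightarrow> mform \<Rightarrow> bool" where
  "mform_ok n e (MX i) \<longleftrightarrow> i < n"
| "mform_ok n e (MY j) \<longleftrightarrow> j < e"
| "mform_ok n e (MConst t) \<longleftrightarrow> True"
| "mform_ok n e (MAnd a b) \<longleftrightarrow> mform_ok n e a \<and> mform_ok n e b"
| "mform_ok n e (MOr a b) \<longleftrightarrow> mform_ok n e a \<and> mform_ok n e b"

text \<open>The first argument is the position that the first gate of the result will occupy.\<close>

fun compile :: "nat \<Rightarrow> mform \<Rightarrow> circuit" where
  "compile p (MX i) = [XIn i]"
| "compile p (MY j) = [YIn j]"
| "compile p (MConst t) = [ConstG t]"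
| "compile p (MAnd a b) = compile p a @ compile (p + mform_nodes a) b @
     [AndG (p + mform_nodes a - 1) (p + mform_nodes a + mform_nodes b - 1)]"
| "compile p (MOr a b) = compile p a @ compile (p + mform_nodes a) b @
     [OrG (p + mform_nodes a - 1) (p + mform_nodes a + mform_nodes b - 1)]"

lemma mform_nodes_pos [simp]: "mform_nodes f > 0"
  by (cases f) auto

lemma length_compile [simp]: "length (compile p f) = mform_nodes f"
  by (induction f arbitrary: p) auto

lemma compile_gates_ok:
  assumes "mform_ok n e f" "i < mform_nodes f"
  shows "gate_inputs_ok n e (compile p f ! i) \<and> (\<forall>q\<in>set (gate_args (compile p f ! i)). q < p + i)"
  using assms
proof (induction f arbitrary: p i)
  case (MAnd a b)
  \<comment> \<open>Position \<open>i\<close> lies in the left block, in the right block, or is the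
    top gate.\<close>
  consider "i < mform_nodes a" | "mform_nodes a \<le> i" "i < mform_nodes a + mform_nodes b"
    | "i = mform_nodes a + mform_nodes b"
    using MAnd.prems by fastforce
  then show ?case
  proof cases
    case 1
    then show ?thesis using MAnd.IH(1)[of i p] MAnd.prems by (simp add: nth_append)
  next
    case 2
    then show ?thesis
      using MAnd.IH(2)[of "i - mform_nodes a" "p + mform_nodes a"] MAnd.prems
      by (simp add: nth_append less_diff_conv2)
  next
    case 3
    then show ?thesis
      using mform_nodes_pos[of a] mform_nodes_pos[of b]
      by (auto simp: nth_append simp del: mform_nodes_pos)
  qed
next
  case (MOr a b)
  consider "i < mform_nodes a" | "mform_nodes a \<le> i" "i < mform_nodes a + mform_nodes b"
    | "i = mform_nodes a + mform_nodes b"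
    using MOr.prems by fastforce
  then show ?case
  proof cases
    case 1
    then show ?thesis using MOr.IH(1)[of i p] MOr.prems by (simp add: nth_append)
  next
    case 2
    then show ?thesis
      using MOr.IH(2)[of "i - mform_nodes a" "p + mform_nodes a"] MOr.prems
      by (simp add: nth_append less_diff_conv2)
  next
    case 3
    then show ?thesis
      using mform_nodes_pos[of a] mform_nodes_pos[of b]
      by (auto simp: nth_append simp del: mform_nodes_pos)
  qed
qed auto

lemma is_circuit_compile:
  assumes "mform_ok n e f"
  shows "is_circuit n e (compile 0 f)"
proof -
  have "compile 0 f \<noteq> []"
    using mform_nodes_pos[of f] by (metis length_compile length_greater_0_conv)
  then show ?thesis
    using compile_gates_ok[OF assms, of _ 0] by (simp add: is_circuit_def)
qed

lemma count_gate_args_compile: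
  "count_list (concat (map gate_args (compile p f))) i =
     (if p \<le> i \<and> i < p + mform_nodes f - 1 then 1 else 0)"
proof (induction f arbitrary: p)
  case (MAnd a b)
  then show ?case
    using mform_nodes_pos[of a] mform_nodes_pos[of b] by (auto simp del: mform_nodes_pos)
next
  case (MOr a b)
  then show ?case
    using mform_nodes_pos[of a] mform_nodes_pos[of b] by (auto simp del: mform_nodes_pos)
qed auto

lemma is_formula_compile: "is_formula (compile 0 f)"
  by (simp add: is_formula_def count_gate_args_compile)

text \<open>The list \<open>vs\<close> of earlier values is arbitrary because the right subformula
  is evaluated after the left one. Gate arguments are absolute positions, hence the offset
  \<open>length vs\<close>.\<close>

lemma foldl_compile:
  "\<exists>ws. foldl (\<lambda>vs g. vs @ [gate_val x y vs g]) vs (compile (length vs) f) = vs @ ws \<and>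
     length ws = mform_nodes f \<and> last ws = mform_val x y f"
proof (induction f arbitrary: vs)
  case (MAnd a b)
  obtain ws where ws: "foldl (\<lambda>vs g. vs @ [gate_val x y vs g]) vs (compile (length vs) a) = vs @ ws"
    "length ws = mform_nodes a" "last ws = mform_val x y a" using MAnd.IH(1) by blast
  obtain ws' where ws': "foldl (\<lambda>vs g. vs @ [gate_val x y vs g]) (vs @ ws)
      (compile (length vs + mform_nodes a) b) = vs @ ws @ ws'"
    "length ws' = mform_nodes b" "last ws' = mform_val x y b"
    using MAnd.IH(2)[of "vs @ ws"] ws(2) by auto
  have "ws \<noteq> []" "ws' \<noteq> []"
    using ws(2) ws'(2) mform_nodes_pos[of a] mform_nodes_pos[of b] by fastforce+
  \<comment> \<open>These are the two positions read by the top gate: the last values of the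
    nonempty blocks \<open>ws\<close> and \<open>ws'\<close>.\<close>
  then have "(vs @ ws @ ws') ! (length vs + mform_nodes a - 1) = mform_val x y a"
    "(vs @ ws @ ws') ! (length vs + mform_nodes a + mform_nodes b - 1) = mform_val x y b"
    using ws(2,3) ws'(2,3) mform_nodes_pos[of a] mform_nodes_pos[of b]
    by (auto simp: nth_append last_conv_nth simp del: mform_nodes_pos)
  then show ?case using ws ws' by auto
next
  case (MOr a b)
  obtain ws where ws: "foldl (\<lambda>vs g. vs @ [gate_val x y vs g]) vs (compile (length vs) a) = vs @ ws"
    "length ws = mform_nodes a" "last ws = mform_val x y a" using MOr.IH(1) by blast
  obtain ws' where ws': "foldl (\<lambda>vs g. vs @ [gate_val x y vs g]) (vs @ ws)
      (compile (length vs + mform_nodes a) b) = vs @ ws @ ws'"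
    "length ws' = mform_nodes b" "last ws' = mform_val x y b"
    using MOr.IH(2)[of "vs @ ws"] ws(2) by auto
  have "ws \<noteq> []" "ws' \<noteq> []"
    using ws(2) ws'(2) mform_nodes_pos[of a] mform_nodes_pos[of b] by fastforce+
  then have "(vs @ ws @ ws') ! (length vs + mform_nodes a - 1) = mform_val x y a"
    "(vs @ ws @ ws') ! (length vs + mform_nodes a + mform_nodes b - 1) = mform_val x y b"
    using ws(2,3) ws'(2,3) mform_nodes_pos[of a] mform_nodes_pos[of b]
    by (auto simp: nth_append last_conv_nth simp del: mform_nodes_pos)
  then show ?case using ws ws' by auto
qed auto

lemma circuit_val_compile: "circuit_val (compile 0 f) x y = mform_val x y f"
  using foldl_compile[of x y "[]" f] by (auto simp: circuit_val_def)

section \<open>Conjunctions of clauses with one oracle input each\<close>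

definition mclause :: "nat list \<Rightarrow> nat \<Rightarrow> mform" where
  "mclause Z j = foldr (\<lambda>i. MOr (MX i)) Z (MY j)"

text \<open>The index \<open>j\<close> does double duty: it selects the list of coordinates and
  names the oracle input of its clause.\<close>

definition mcnf :: "nat list list \<Rightarrow> mform" where
  "mcnf Zs = foldr (\<lambda>j. MAnd (mclause (Zs ! j) j)) [0..<length Zs] (MConst True)"

lemma mform_val_mclause:
  "mform_val x y (mclause Z j) \<longleftrightarrow> (\<exists>i\<in>set Z. x ! i) \<or> y j"
  unfolding mclause_def by (induction Z) auto

lemma mform_nodes_mclause: "mform_nodes (mclause Z j) = 2 * length Z + 1"
  unfolding mclause_def by (induction Z) auto

lemma mform_ok_mclause:
  "mform_ok n e (mclause Z j) \<longleftrightarrow> set Z \<subseteq> {..<n} \<and> j < e"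
  unfolding mclause_def by (induction Z) auto

lemma mform_val_mcnf:
  "mform_val x y (mcnf Zs) \<longleftrightarrow> (\<forall>j<length Zs. (\<exists>i\<in>set (Zs ! j). x ! i) \<or> y j)"
proof -
  have "mform_val x y (foldr (\<lambda>j. MAnd (mclause (Zs ! j) j)) js (MConst True)) \<longleftrightarrow>
      (\<forall>j\<in>set js. (\<exists>i\<in>set (Zs ! j). x ! i) \<or> y j)" for js
    by (induction js) (auto simp: mform_val_mclause)
  then show ?thesis by (auto simp: mcnf_def)
qed

lemma mform_ok_mcnf:
  assumes "\<And>Z. Z \<in> set Zs \<Longrightarrow> set Z \<subseteq> {..<n}"
  shows "mform_ok n (length Zs) (mcnf Zs)"
proof -
  \<comment> \<open>Generalised to index lists \<open>js\<close> for the induction; the bound on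
    \<open>js\<close> keeps \<open>Zs ! j\<close> a member of \<open>Zs\<close>.\<close>
  have "mform_ok n (length Zs) (foldr (\<lambda>j. MAnd (mclause (Zs ! j) j)) js (MConst True))"
    if "set js \<subseteq> {..<length Zs}" for js
    using that assms by (induction js) (auto simp: mform_ok_mclause)
  then show ?thesis by (simp add: mcnf_def lessThan_atLeast0)
qed

text \<open>Each conjunct costs \<open>2 * W + 1\<close> nodes and one conjunction gate; the last
  node is the constant ending the fold.\<close>

lemma mform_nodes_mcnf:
  assumes "\<And>Z. Z \<in> set Zs \<Longrightarrow> length Z = W"
  shows "mform_nodes (mcnf Zs) = length Zs * (2 * W + 2) + 1"
proof -
  have "mform_nodes (foldr (\<lambda>j. MAnd (mclause (Zs ! j) j)) js (MConst True))
      = length js * (2 * W + 2) + 1"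
    if "set js \<subseteq> {..<length Zs}" for js
    using that assms by (induction js) (auto simp: mform_nodes_mclause)
  from this[of "[0..<length Zs]"] show ?thesis by (simp add: mcnf_def lessThan_atLeast0)
qed

section \<open>The formula with a local oracle\<close>

text \<open>Padding with the first zero makes the length exactly \<open>W\<close>, so a
  \<open>v\<close> with some zero (as \<open>hd\<close> presupposes) gets one of the
  \<open>n ^ W\<close> words over the coordinates. With at least \<open>W\<close> zeros,
  \<open>take\<close> cuts the padding off.\<close>

definition zero_list :: "nat \<Rightarrow> nat \<Rightarrow> bool list \<Rightarrow> nat list" where
  "zero_list n W v = (let zs = filter (\<lambda>i. \<not> v ! i) [0..<n] in take W (zs @ replicate W (hd zs)))"

lemma zero_list_properties:
  assumes "\<exists>i<n. \<not> v ! i"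
  shows "length (zero_list n W v) = W"
    and "set (zero_list n W v) \<subseteq> {i. i < n \<and> \<not> v ! i}"
    and "card (set (zero_list n W v)) = W \<or> set (zero_list n W v) = {i. i < n \<and> \<not> v ! i}"
proof -
  define zs where "zs = filter (\<lambda>i. \<not> v ! i) [0..<n]"
  have zl: "zero_list n W v = take W (zs @ replicate W (hd zs))"
    by (simp only: zero_list_def zs_def Let_def)
  have setzs: "set zs = {i. i < n \<and> \<not> v ! i}" by (auto simp: zs_def)
  have hd: "hd zs \<in> set zs"
    using assms by (intro hd_in_set) (auto simp: zs_def filter_empty_conv)
  have dist: "distinct zs" by (simp add: zs_def)
  show "length (zero_list n W v) = W" by (simp add: zl)
  have "set (zero_list n W v) \<subseteq> set (zs @ replicate W (hd zs))"
    unfolding zl by (rule set_take_subset)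
  then show sub: "set (zero_list n W v) \<subseteq> {i. i < n \<and> \<not> v ! i}"
    using hd setzs by (auto split: if_splits)
  show "card (set (zero_list n W v)) = W \<or> set (zero_list n W v) = {i. i < n \<and> \<not> v ! i}"
  proof (cases "W \<le> length zs")
    case True
    then have "zero_list n W v = take W zs" by (simp add: zl)
    then show ?thesis using dist True distinct_card[of "take W zs"] by simp
  next
    case False
    then have "set zs \<subseteq> set (zero_list n W v)" by (auto simp: zl)
    then show ?thesis using sub setzs by blast
  qed
qed

lemma upset_CLO:
  assumes U: "U \<subseteq> cube n" "U \<noteq> {}" and V: "V \<subseteq> cube n" "V \<noteq> {}"
    and up: "\<forall>u\<in>U. \<forall>u'\<in>cube n. cube_le u u' \<longrightarrow> u' \<in> U"
    and disj: "U \<inter> V = {}"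
  shows "\<exists>K. monotone_CLO n U V K \<and> clo_size K = n ^ W * (2 * W + 2) + 1 \<and>
           clo_locality U V K \<le> 1 / 2 ^ W \<and> is_formula (circ K)"
proof -
  define Zs where "Zs = List.n_lists W [0..<n]"
  define K where "K = \<lparr>circ = compile 0 (mcnf Zs), num_orc = length Zs,
    orc_U = (\<lambda>j. {u\<in>U. \<forall>i\<in>set (Zs ! j). \<not> u ! i}),
    orc_V = (\<lambda>j. {v\<in>V. zero_list n W v = Zs ! j})\<rparr>"
  have Zs_iff: "Z \<in> set Zs \<longleftrightarrow> length Z = W \<and> set Z \<subseteq> {..<n}" for Z
    by (auto simp: Zs_def set_n_lists)
  have dist: "distinct Zs" by (simp add: Zs_def distinct_n_lists)
  have finU: "finite U" and finV: "finite V"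
    using U V finite_cube finite_subset by blast+
  have sep: "\<exists>i<n. u ! i \<and> \<not> v ! i" if "u \<in> U" "v \<in> V" for u v
  \<comment> \<open>Otherwise \<open>u\<close> lies below \<open>v\<close>, and upward closure puts
    \<open>v\<close> into \<open>U\<close>.\<close>
  proof (rule ccontr)
    assume "\<not> ?thesis"
    then have "cube_le u v"
      using that U V by (auto simp: cube_le_def list_all2_conv_all_nth cube_def)
    then have "v \<in> U" using up that V by blast
    then show False using that disj by blast
  qed
  have zero: "\<exists>i<n. \<not> v ! i" if "v \<in> V" for v
    using sep U(2) that by blast
  have zl_in: "zero_list n W v \<in> set Zs" if "v \<in> V" for v
    using zero_list_properties[OF zero[OF that], of W] by (auto simp: Zs_iff)
  have "monotone_CLO n U V K"
    unfolding monotone_CLO_def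
  proof (intro conjI allI impI)
    show "is_circuit n (num_orc K) (circ K)"
      using is_circuit_compile[OF mform_ok_mcnf[of Zs n]] Zs_iff by (simp add: K_def)
    show "orc_U K j \<subseteq> U" "orc_V K j \<subseteq> V" for j by (auto simp: K_def)
    fix f :: "nat \<Rightarrow> bool list \<Rightarrow> bool"
    assume f: "\<forall>j<num_orc K. monotone_on_cube n (f j) \<and>
      f j ` orc_U K j \<subseteq> {True} \<and> f j ` orc_V K j \<subseteq> {False}"
    have fU: "f j u" if "j < length Zs" "u \<in> U" "\<forall>i\<in>set (Zs ! j). \<not> u ! i" for j u
    proof -
      have "f j ` orc_U K j \<subseteq> {True}" using f that by (simp add: K_def)
      moreover have "u \<in> orc_U K j" using that by (simp add: K_def)
      ultimately show ?thesis by blast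
    qed
    have fV: "\<not> f j v" if "j < length Zs" "v \<in> V" "zero_list n W v = Zs ! j" for j v
    proof -
      have "f j ` orc_V K j \<subseteq> {False}" using f that by (simp add: K_def)
      moreover have "v \<in> orc_V K j" using that by (simp add: K_def)
      ultimately show ?thesis by blast
    qed
    have val: "circuit_val (circ K) x (\<lambda>j. f j x) \<longleftrightarrow>
        (\<forall>j<length Zs. (\<exists>i\<in>set (Zs ! j). x ! i) \<or> f j x)" for x
      by (simp add: K_def circuit_val_compile mform_val_mcnf)
    \<comment> \<open>For each \<open>j\<close>, either \<open>u\<close> has a one on
      \<open>Zs ! j\<close>, or \<open>u\<close> lies in \<open>orc_U K j\<close>, where the oracle
      answers True.\<close>
    have "circuit_val (circ K) u (\<lambda>j. f j u)" if "u \<in> U" for u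
      unfolding val using fU that by blast
    then show "(\<lambda>x. circuit_val (circ K) x (\<lambda>j. f j x)) ` U = {True}"
      using U(2) by auto
    \<comment> \<open>The clause of the list attached to \<open>v\<close> fails: \<open>v\<close>
      vanishes on that list and its oracle answers False.\<close>
    have "\<not> circuit_val (circ K) v (\<lambda>j. f j v)" if v: "v \<in> V" for v
    proof -
      obtain j where j: "j < length Zs" "Zs ! j = zero_list n W v"
        using zl_in[OF v] by (auto simp: in_set_conv_nth)
      then have "\<not> f j v" using fV v by simp
      then show ?thesis
        unfolding val using j zero_list_properties(2)[OF zero[OF v], of W]
        by (metis (no_types, lifting) mem_Collect_eq subsetD)
    qed
    then show "(\<lambda>x. circuit_val (circ K) x (\<lambda>j. f j x)) ` V = {False}"
      using V(2) by auto
  qed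
  moreover have "clo_size K = n ^ W * (2 * W + 2) + 1"
    using mform_nodes_mcnf[of Zs W]
    by (simp add: clo_size_def K_def Zs_iff) (simp add: Zs_def length_n_lists)
  moreover have "clo_locality U V K \<le> 1 / 2 ^ W"
  proof -
    have rect: "card (orc_U K j \<times> orc_V K j) * 2 ^ W \<le> card U * card (orc_V K j)" for j
    proof (cases "orc_V K j = {}")
      case False
      then obtain v where v: "v \<in> V" "zero_list n W v = Zs ! j" by (auto simp: K_def)
      note props = zero_list_properties[OF zero[OF v(1)], of W, unfolded v(2)]
      have "card (orc_U K j) * 2 ^ W \<le> card U"
      proof (cases "card (set (Zs ! j)) = W")
        case True
        then show ?thesis
          using card_upset_vanishing[OF U(1) up, of "set (Zs ! j)"] props(2)
          by (auto simp: K_def)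
      next
        case False
        \<comment> \<open>Here the list contains all zeros of \<open>v\<close>, and by
          \<open>sep\<close> every member of \<open>U\<close> has a one at some zero of
          \<open>v\<close>.\<close>
        then have "set (Zs ! j) = {i. i < n \<and> \<not> v ! i}" using props(3) by blast
        then have "orc_U K j = {}" using sep[OF _ v(1)] by (auto simp: K_def)
        then show ?thesis by simp
      qed
      then show ?thesis
        using mult_le_mono1[of _ "card U" "card (orc_V K j)"]
        by (simp add: card_cartesian_product ac_simps)
    qed simp
    have finorc: "finite (orc_U K j)" "finite (orc_V K j)" for j
      using finU finV by (auto simp: K_def)
    \<comment> \<open>The sets \<open>orc_V K j\<close> are disjoint: each \<open>v\<close> has one
      attached list, and \<open>Zs\<close> has no repetitions.\<close>
    have "(\<Sum>j<length Zs. card (orc_V K j)) = card (\<Union>j<length Zs. orc_V K j)"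
      using dist finorc
      by (intro card_UN_disjoint[symmetric]) (auto simp: K_def distinct_conv_nth)
    also have "\<dots> \<le> card V"
      using finV by (intro card_mono) (auto simp: K_def)
    finally have sumV: "(\<Sum>j<length Zs. card (orc_V K j)) \<le> card V" .
    have "card (\<Union>j<num_orc K. orc_U K j \<times> orc_V K j) * 2 ^ W
        \<le> (\<Sum>j<length Zs. card (orc_U K j \<times> orc_V K j)) * 2 ^ W"
      by (intro mult_le_mono1) (simp add: K_def card_UN_le)
    also have "\<dots> \<le> (\<Sum>j<length Zs. card U * card (orc_V K j))"
      unfolding sum_distrib_right by (intro sum_mono rect)
    also have "\<dots> \<le> card U * card V"
      unfolding sum_distrib_left[symmetric] using sumV by simp
    finally have "real (card (\<Union>j<num_orc K. orc_U K j \<times> orc_V K j) * 2 ^ W) \<le> real (card (U \<times> V))"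
      unfolding card_cartesian_product of_nat_le_iff .
    moreover have "card (U \<times> V) > 0"
      using U V finU finV by (simp add: card_gt_0_iff)
    ultimately show ?thesis
      by (simp add: clo_locality_def field_simps)
  qed
  moreover have "is_formula (circ K)" by (simp add: K_def is_formula_compile)
  ultimately show ?thesis by blast
qed

text \<open>Upward closure puts \<open>[True]\<close> into \<open>U\<close>, and disjointness then
  leaves \<open>{[True]}\<close> and \<open>{[False]}\<close>; the single input separates these
  without any oracle, so the locality is 0.\<close>

lemma upset_CLO_one:
  assumes U: "U \<subseteq> cube 1" "U \<noteq> {}" and V: "V \<subseteq> cube 1" "V \<noteq> {}"
    and up: "\<forall>u\<in>U. \<forall>u'\<in>cube 1. cube_le u u' \<longrightarrow> u' \<in> U"
    and disj: "U \<inter> V = {}"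
  shows "\<exists>K. monotone_CLO 1 U V K \<and> clo_size K = 1 \<and> clo_locality U V K = 0 \<and>
           is_formula (circ K)"
proof -
  have cube: "cube 1 = {[False], [True]}"
    by (auto simp: cube_def length_Suc_conv)
  have "[True] \<in> U"
  proof -
    obtain u where "u \<in> U" using U(2) by blast
    moreover have "cube_le u [True]" using U(1) \<open>u \<in> U\<close> unfolding cube by (auto simp: cube_le_def)
    ultimately show ?thesis using up unfolding cube by blast
  qed
  then have "V = {[False]}" using V disj unfolding cube by blast
  then have "U = {[True]}" using U disj unfolding cube by blast
  define K where "K = \<lparr>circ = compile 0 (MX 0), num_orc = 0, orc_U = (\<lambda>_. {}), orc_V = (\<lambda>_. {})\<rparr>"
  have "monotone_CLO 1 U V K"
    unfolding monotone_CLO_def \<open>U = _\<close> \<open>V = _\<close> K_def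
    using is_circuit_compile[of 1 0 "MX 0"] by (simp add: circuit_val_def)
  then show ?thesis
    using is_formula_compile[of "MX 0"]
    by (intro exI[of _ K]) (simp add: clo_size_def clo_locality_def K_def)
qed

section \<open>Numerical estimate of the size\<close>

lemma formula_size_bound:
  fixes n W :: nat and k w :: real
  assumes "n \<ge> 2" "real W \<le> 2 * w" "k \<ge> 1"
  shows "real (n ^ W * (2 * W + 2) + 1) \<le> (k + real n) * 2 powr (4 * w * log 2 (real n))"
proof -
  \<comment> \<open>The factor linear in \<open>W\<close> is absorbed into a second factor
    \<open>n ^ W\<close>.\<close>
  have "W + 1 \<le> 2 ^ W" by (simp add: Suc_le_eq)
  also have "(2::nat) ^ W \<le> n ^ W" using assms(1) by (simp add: power_mono)
  finally have "n ^ W * (W + 1) \<le> n ^ W * n ^ W" by (rule mult_le_mono2)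
  moreover have "1 \<le> n ^ W * n ^ W" using assms(1) by simp
  ultimately have "n ^ W * (2 * W + 2) + 1 \<le> 3 * (n ^ W * n ^ W)"
    by (simp add: algebra_simps)
  then have "real (n ^ W * (2 * W + 2) + 1) \<le> real (3 * (n ^ W * n ^ W))"
    using of_nat_le_iff by blast
  also have "\<dots> = 3 * real n ^ (2 * W)"
    by (simp add: mult_2 power_add)
  also have "real n ^ (2 * W) = real n powr (2 * real W)"
    using assms(1) powr_realpow[of "real n" "2 * W"] by simp
  also have "\<dots> \<le> real n powr (4 * w)"
    using assms by (intro powr_mono) auto
  also have "\<dots> = (2 powr log 2 (real n)) powr (4 * w)"
    using assms(1) by simp
  also have "\<dots> = 2 powr (4 * w * log 2 (real n))"
    by (simp add: powr_powr mult.commute)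
  \<comment> \<open>The constant 3 is at most \<open>k + n\<close>, as \<open>k\<close> is at least
    1 and \<open>n\<close> at least 2.\<close>
  also have "3 * 2 powr (4 * w * log 2 (real n)) \<le> (k + real n) * 2 powr (4 * w * log 2 (real n))"
    using assms by (intro mult_right_mono) auto
  finally show ?thesis by simp
qed

theorem corollary5p4:
  "\<exists>c::real. c > 0 \<and>
    (\<forall>(N::nat) (n::nat) (s::nat) (r::nat) (m::nat) (l::nat)
      (A :: nat \<Rightarrow> clause) (B :: nat \<Rightarrow> clause) (\<pi> :: derivation) (k::nat) (w::real).
      N = n + s + r \<longrightarrow> N \<ge> 1 \<longrightarrow> n \<ge> 1 \<longrightarrow>
      (\<forall>j<m. clause_over (xy_vars n s) (A j)) \<longrightarrow>
      (\<forall>j<l. clause_over (xz_vars n r) (B j)) \<longrightarrow>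
      U_set n s m A \<noteq> {} \<longrightarrow> V_set n r l B \<noteq> {} \<longrightarrow>
      (\<forall>u\<in>cube n. \<forall>u'\<in>cube n. \<forall>b\<in>cube s.
         (u, b) \<in> A_inter n s m A \<longrightarrow> cube_le u u' \<longrightarrow> (u', b) \<in> A_inter n s m A) \<longrightarrow>
      is_refutation (xyz_vars n s r) (A ` {..<m} \<union> B ` {..<l}) \<pi> \<longrightarrow>
      length \<pi> = k \<longrightarrow> w \<ge> 1 \<longrightarrow>
      (\<exists>K :: clo.
         monotone_CLO n (U_set n s m A) (V_set n r l B) K \<and>
         real (clo_size K) \<le> (real k + real n) * 2 powr (c * w * log 2 (real n)) \<and>
         clo_locality (U_set n s m A) (V_set n r l B) K \<le> 3 * 2 powr (- w) * real k \<and>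
         (tree_like \<pi> \<longrightarrow> is_formula (circ K))))"
\<comment> \<open>The size is of order \<open>n ^ (2 * W)\<close> and \<open>W \<le> 2 * w\<close>,
  whence the constant 4.\<close>
proof (rule exI[of _ 4], intro conjI allI impI)
  fix N n s r m l k :: nat and A B :: "nat \<Rightarrow> clause" and \<pi> :: derivation and w :: real
  let ?U = "U_set n s m A" and ?V = "V_set n r l B"
  assume n: "n \<ge> 1"
    and A: "\<forall>j<m. clause_over (xy_vars n s) (A j)"
    and B: "\<forall>j<l. clause_over (xz_vars n r) (B j)"
    and Une: "?U \<noteq> {}" and Vne: "?V \<noteq> {}"
    and mono: "\<forall>u\<in>cube n. \<forall>u'\<in>cube n. \<forall>b\<in>cube s.
         (u, b) \<in> A_inter n s m A \<longrightarrow> cube_le u u' \<longrightarrow> (u', b) \<in> A_inter n s m A"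
    and ref: "is_refutation (xyz_vars n s r) (A ` {..<m} \<union> B ` {..<l}) \<pi>"
    and k: "length \<pi> = k" and w: "w \<ge> 1"
  have U: "?U \<subseteq> cube n" and V: "?V \<subseteq> cube n" by (auto simp: U_set_def V_set_def)
  have up: "\<forall>u\<in>?U. \<forall>u'\<in>cube n. cube_le u u' \<longrightarrow> u' \<in> ?U"
    using mono unfolding U_set_def by blast
  have disj: "?U \<inter> ?V = {}" by (rule U_V_disjoint[OF A B ref])
  \<comment> \<open>This gives \<open>3 * k \<ge> 1\<close> for the locality and
    \<open>k + n \<ge> 3\<close> for the size when \<open>n \<ge> 2\<close>.\<close>
  have "k \<ge> 1" using ref k by (cases \<pi>) (auto simp: is_refutation_def)
  show "\<exists>K. monotone_CLO n ?U ?V K \<and>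
         real (clo_size K) \<le> (real k + real n) * 2 powr (4 * w * log 2 (real n)) \<and>
         clo_locality ?U ?V K \<le> 3 * 2 powr (- w) * real k \<and>
         (tree_like \<pi> \<longrightarrow> is_formula (circ K))"
  proof (cases "n = 1")
    case True
    then obtain K where "monotone_CLO n ?U ?V K" "clo_size K = 1" "clo_locality ?U ?V K = 0"
      "is_formula (circ K)"
      using upset_CLO_one[of ?U ?V] U V Une Vne up disj by auto
    then show ?thesis using True \<open>k \<ge> 1\<close> by (intro exI[of _ K]) simp
  next
    case False
    define W where "W = nat \<lceil>w\<rceil>"
    \<comment> \<open>Rounding up adds less than 1, which is at most \<open>w\<close>.\<close>
    have W: "w \<le> real W" "real W \<le> 2 * w" using w unfolding W_def by linarith+
    obtain K where K: "monotone_CLO n ?U ?V K" "clo_size K = n ^ W * (2 * W + 2) + 1"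
      "clo_locality ?U ?V K \<le> 1 / 2 ^ W" "is_formula (circ K)"
      using upset_CLO[OF U Une V Vne up disj, where W = W] by blast
    have "1 / 2 ^ W = 2 powr (- real W)"
      by (simp add: powr_minus powr_realpow inverse_eq_divide)
    also have "\<dots> \<le> 2 powr (- w)" using W by simp
    also have "\<dots> \<le> 3 * 2 powr (- w) * real k"
      using \<open>k \<ge> 1\<close> mult_left_mono[of 1 "3 * real k" "2 powr (- w)"] by (simp add: mult_ac)
    finally have "1 / 2 ^ W \<le> 3 * 2 powr (- w) * real k" .
    moreover have "real (clo_size K) \<le> (real k + real n) * 2 powr (4 * w * log 2 (real n))"
      unfolding K(2) using n False W \<open>k \<ge> 1\<close> by (intro formula_size_bound) auto
    ultimately show ?thesis using K by (intro exI[of _ K]) auto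
  qed
qed simp

end
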